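(* Let $X$ be a pseudo-metrizable topological space, let $S$ be a sequential directed set, and let $(X_s)_{s \in S}$ be a net of nonempty subsets of $X$. Then the following properties are equivalent: (a) $(X_s)_{s \in S}$ converges from above to some nonempty compact set $K \subset X$. (b) $(X_s)_{s \in S}$ is asymptotically sequentially compact. (c) $(X_s)_{s \in S}$ is weakly asymptotically sequentially compact. (d) $(X_s)_{s \in S}$ is limit set compact.
   Context: A directed set is a nonempty set with a preorder (reflexive, transitive relation) $\le$ in which every pair of elements has an upper bound. For a sequence $(s_n)_{n=1}^\infty$ in a directed set $S$, write $s_n \to \mathrm{bd}(S)$ as $n \to \infty$ if for every $s \in S$ there is $n_0 \ge 1$ such that $s_n \ge s$ for all $n \ge n_0$. A directed set $S$ is sequential if there exists a sequence $(s_n)_{n=1}^\infty$ in $S$ with $s_n \to \mathrm{bd}(S)$. A sequence $(s_n)_{n=1}^\infty$ in $S$ is monotone if $m \le n$ implies $s_m \le s_n$, and final if for every $s \in S$ there is $n$ with $s_n \ge s$. A subsequence of $(x_n)_{n=1}^\infty$ is a sequence $(x_{n_k})_{k=1}^\infty$ with $n_k \to \infty$ as $k \to \infty$. A (sequence-indexed) subnet $(X_{s_n})_{n=1}^\infty$ of $(X_s)_{s \in S}$ is given by a sequence $(s_n)_{n=1}^\infty$ in $S$ with $s_n \to \mathrm{bd}(S)$. Compactness means every open cover has a finite subcover (no Hausdorff assumption). The limit set of $(X_s)_{s \in S}$ is $L(X_s)_{s \in S} = \bigcap_{s \in S} \mathrm{cl} \bigcup_{t \in S, t \ge s} X_t$.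 $(X_s)_{s \in S}$ converges from above to $A \subset X$ if for every neighborhood $U$ of $A$ there is $s \in S$ with $\bigcup_{t \in S, t \ge s} X_t \subset U$. $(X_s)_{s \in S}$ is asymptotically sequentially compact if (i) $S$ is sequential and (ii) for every subnet $(X_{s_n})_{n=1}^\infty$ of $(X_s)_{s \in S}$ and every $(y_n)_{n=1}^\infty \in \prod_{n=1}^\infty X_{s_n}$, the sequence $(y_n)_{n=1}^\infty$ has a convergent subsequence in $X$. $(X_s)_{s \in S}$ is weakly asymptotically sequentially compact if (i) $S$ is sequential and (ii) for every monotone final sequence $(s_n)_{n=1}^\infty$ in $S$ and every $(y_n)_{n=1}^\infty \in \prod_{n=1}^\infty \bigcup_{t \in S, t \ge s_n} X_t$, the sequence $(y_n)_{n=1}^\infty$ has a convergent subsequence in $X$. $(X_s)_{s \in S}$ is limit set compact if $L(X_s)_{s \in S}$ is a nonempty compact set and $(X_s)_{s \in S}$ converges from above to $L(X_s)_{s \in S}$. *)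

theory Defs
  imports "HOL-Analysis.Analysis"
begin

text \<open>
  Directed sets are given by a carrier \<open>S\<close> together with a relation \<open>le\<close>, of which only the
  restriction to \<open>S\<close> matters. Sequences are functions on \<open>nat\<close>, hence indexed from 0 instead of 1.
\<close>

definition directed_set :: "'s set \<Rightarrow> ('s \<Rightarrow> 's \<Rightarrow> bool) \<Rightarrow> bool" where
  "directed_set S le \<longleftrightarrow>
     S \<noteq> {} \<and> reflp_on S le \<and> transp_on S le \<and>
     (\<forall>s\<in>S. \<forall>t\<in>S. \<exists>u\<in>S. le s u \<and> le t u)"

definition tends_to_bd :: "'s set \<Rightarrow> ('s \<Rightarrow> 's \<Rightarrow> bool) \<Rightarrow> (nat \<Rightarrow> 's) \<Rightarrow> bool" where
  "tends_to_bd S le \<sigma> \<longleftrightarrow> (\<forall>s\<in>S. \<exists>n0. \<forall>n\<ge>n0. le s (\<sigma> n))"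

definition sequential_directed :: "'s set \<Rightarrow> ('s \<Rightarrow> 's \<Rightarrow> bool) \<Rightarrow> bool" where
  "sequential_directed S le \<longleftrightarrow> (\<exists>\<sigma>. range \<sigma> \<subseteq> S \<and> tends_to_bd S le \<sigma>)"

definition final_seq :: "'s set \<Rightarrow> ('s \<Rightarrow> 's \<Rightarrow> bool) \<Rightarrow> (nat \<Rightarrow> 's) \<Rightarrow> bool" where
  "final_seq S le \<sigma> \<longleftrightarrow> (\<forall>s\<in>S. \<exists>n. le s (\<sigma> n))"

definition pseudometric_on :: "'a set \<Rightarrow> ('a \<Rightarrow> 'a \<Rightarrow> real) \<Rightarrow> bool" where
  "pseudometric_on M d \<longleftrightarrow>
     (\<forall>x\<in>M. d x x = 0) \<and>
     (\<forall>x\<in>M. \<forall>y\<in>M. 0 \<le> d x y \<and> d x y = d y x) \<and>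
     (\<forall>x\<in>M. \<forall>y\<in>M. \<forall>z\<in>M. d x z \<le> d x y + d y z)"

definition pseudo_metrizable_space :: "'a topology \<Rightarrow> bool" where
  "pseudo_metrizable_space X \<longleftrightarrow>
     (\<exists>d. pseudometric_on (topspace X) d \<and>
       (\<forall>U. openin X U \<longleftrightarrow>
          U \<subseteq> topspace X \<and>
          (\<forall>x\<in>U. \<exists>r>0. {y \<in> topspace X. d x y < r} \<subseteq> U)))"

text \<open>Neighbourhoods of sets are not required to be open.\<close>

definition nbhd_of_set :: "'a topology \<Rightarrow> 'a set \<Rightarrow> 'a set \<Rightarrow> bool" where
  "nbhd_of_set X A U \<longleftrightarrow> U \<subseteq> topspace X \<and> (\<exists>V. openin X V \<and> A \<subseteq> V \<and> V \<subseteq> U)"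

text \<open>
  A subsequence is only required to satisfy \<open>n\<^sub>k \<longlongrightarrow> \<infinity>\<close>; the indices need not be strictly
  increasing. The limit lies in \<open>topspace X\<close> by the definition of \<^const>\<open>limitin\<close>.
\<close>

definition has_convergent_subseq :: "'a topology \<Rightarrow> (nat \<Rightarrow> 'a) \<Rightarrow> bool" where
  "has_convergent_subseq X y \<longleftrightarrow>
     (\<exists>\<nu> :: nat \<Rightarrow> nat. filterlim \<nu> at_top sequentially \<and>
        (\<exists>l. limitin X (\<lambda>k. y (\<nu> k)) l sequentially))"

definition tail_union :: "'s set \<Rightarrow> ('s \<Rightarrow> 's \<Rightarrow> bool) \<Rightarrow> ('s \<Rightarrow> 'a set) \<Rightarrow> 's \<Rightarrow> 'a set" where
  "tail_union S le F s = (\<Union>t\<in>{t \<in> S. le s t}. F t)"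

definition limit_set ::
  "'a topology \<Rightarrow> 's set \<Rightarrow> ('s \<Rightarrow> 's \<Rightarrow> bool) \<Rightarrow> ('s \<Rightarrow> 'a set) \<Rightarrow> 'a set" where
  "limit_set X S le F = (\<Inter>s\<in>S. X closure_of tail_union S le F s)"

definition converges_from_above ::
  "'a topology \<Rightarrow> 's set \<Rightarrow> ('s \<Rightarrow> 's \<Rightarrow> bool) \<Rightarrow> ('s \<Rightarrow> 'a set) \<Rightarrow> 'a set \<Rightarrow> bool" where
  "converges_from_above X S le F A \<longleftrightarrow>
     (\<forall>U. nbhd_of_set X A U \<longrightarrow> (\<exists>s\<in>S. tail_union S le F s \<subseteq> U))"

definition asymptotically_seq_compact ::
  "'a topology \<Rightarrow> 's set \<Rightarrow> ('s \<Rightarrow> 's \<Rightarrow> bool) \<Rightarrow> ('s \<Rightarrow> 'a set) \<Rightarrow> bool" where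
  "asymptotically_seq_compact X S le F \<longleftrightarrow>
     sequential_directed S le \<and>
     (\<forall>\<sigma> y. range \<sigma> \<subseteq> S \<and> tends_to_bd S le \<sigma> \<and> (\<forall>n. y n \<in> F (\<sigma> n))
        \<longrightarrow> has_convergent_subseq X y)"

definition weakly_asymptotically_seq_compact ::
  "'a topology \<Rightarrow> 's set \<Rightarrow> ('s \<Rightarrow> 's \<Rightarrow> bool) \<Rightarrow> ('s \<Rightarrow> 'a set) \<Rightarrow> bool" where
  "weakly_asymptotically_seq_compact X S le F \<longleftrightarrow>
     sequential_directed S le \<and>
     (\<forall>\<sigma> y. range \<sigma> \<subseteq> S \<and> monotone (\<le>) le \<sigma> \<and> final_seq S le \<sigma> \<and>
            (\<forall>n. y n \<in> tail_union S le F (\<sigma> n))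
        \<longrightarrow> has_convergent_subseq X y)"

definition limit_set_compact ::
  "'a topology \<Rightarrow> 's set \<Rightarrow> ('s \<Rightarrow> 's \<Rightarrow> bool) \<Rightarrow> ('s \<Rightarrow> 'a set) \<Rightarrow> bool" where
  "limit_set_compact X S le F \<longleftrightarrow>
     limit_set X S le F \<noteq> {} \<and> compactin X (limit_set X S le F) \<and>
     converges_from_above X S le F (limit_set X S le F)"

end

theory Submission
  imports Defs
begin

text \<open>
  The equivalence is proved as the cycle from (a) to (b) to (c) to (d) and back to (a), the last
  step being trivial. The common currency is the notion of a cluster point of a sequence: in a
  pseudo-metrizable space a sequence has a convergent subsequence iff it has a cluster point
  (\<open>has_convergent_subseq_iff_cluster_point\<close>), and cluster points fit both compactness, via covers,
  and the limit set, via closures.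

  From (a) to (b): a sequence running along a subnet eventually enters every neighbourhood of
  the compact set \<open>K\<close>; if no point of \<open>K\<close> were a cluster point, a finite cover by open sets that the
  sequence eventually leaves would be such a neighbourhood
  (\<open>cluster_point_if_converges_from_above\<close>).

  From (b) to (c): a point in a tail of the net lies in a member of larger index, so the sequences
  considered in (c) run along subnets.

  From (c) to (d): since \<open>S\<close> is sequential, it has a monotone final sequence \<open>\<sigma>\<close>, and sequences
  with \<open>n\<close>-th term in the tail at \<open>\<sigma> n\<close> have cluster points, which lie in the limit set \<open>L\<close>. An
  arbitrary such sequence shows that \<open>L\<close> is nonempty. If the net did not converge from above to
  \<open>L\<close>, the sequence could be chosen outside some open \<open>V\<close> containing \<open>L\<close>, and then it could not
  cluster in \<open>L\<close>. Finally, a sequence in \<open>L\<close> is approximated by points of the tails with errors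
  tending to zero, hence it clusters in \<open>L\<close>. That this makes \<open>L\<close> compact
  (\<open>compactin_if_cluster_points\<close>) is the pseudo-metric version of a classical theorem on metric
  spaces, to which it is reduced by choosing one representative from each class of points at
  distance zero.
\<close>

section \<open>Cluster points of sequences in pseudo-metric spaces\<close>

definition cluster_point :: "'a topology \<Rightarrow> (nat \<Rightarrow> 'a) \<Rightarrow> 'a \<Rightarrow> bool" where
  "cluster_point X y l \<longleftrightarrow>
     l \<in> topspace X \<and> (\<forall>U. openin X U \<and> l \<in> U \<longrightarrow> (\<exists>\<^sub>F n in sequentially. y n \<in> U))"

lemma subseq_below_inverse_Suc:
  fixes f :: "nat \<Rightarrow> real"
  assumes "\<And>e. e > 0 \<Longrightarrow> \<exists>\<^sub>F n in sequentially. f n < e"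
  obtains \<nu> where "strict_mono \<nu>" "\<And>k. f (\<nu> k) < inverse (real (Suc k))"
proof -
  have later: "\<exists>n>m. f n < inverse (real (Suc k))" for k m
    using assms[of "inverse (real (Suc k))"] unfolding frequently_sequentially
    by (metis Suc_le_eq inverse_positive_iff_positive of_nat_0_less_iff zero_less_Suc)
  have "\<exists>\<nu>. \<forall>k. f (\<nu> k) < inverse (real (Suc k)) \<and> \<nu> k < \<nu> (Suc k)"
    by (rule dependent_nat_choice) (use later in blast)+
  with that show thesis
    by (auto simp: strict_mono_Suc_iff)
qed

lemma inverse_Suc_eventually_less:
  assumes "(e::real) > 0"
  shows "\<forall>\<^sub>F n in sequentially. inverse (real (Suc n)) < e"
  using order_tendstoD(2)[OF LIMSEQ_inverse_real_of_nat assms] .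

locale pseudometric_topology =
  fixes X :: "'a topology" and d :: "'a \<Rightarrow> 'a \<Rightarrow> real"
  assumes pseudometric: "pseudometric_on (topspace X) d"
    and openin_iff: "openin X U \<longleftrightarrow> U \<subseteq> topspace X \<and>
          (\<forall>x\<in>U. \<exists>r>0. {y \<in> topspace X. d x y < r} \<subseteq> U)"
begin

lemma dist_self: "x \<in> topspace X \<Longrightarrow> d x x = 0"
  and dist_nonneg: "x \<in> topspace X \<Longrightarrow> y \<in> topspace X \<Longrightarrow> 0 \<le> d x y"
  and dist_commute: "x \<in> topspace X \<Longrightarrow> y \<in> topspace X \<Longrightarrow> d x y = d y x"
  and dist_triangle: "x \<in> topspace X \<Longrightarrow> y \<in> topspace X \<Longrightarrow> z \<in> topspace X \<Longrightarrow>
        d x z \<le> d x y + d y z"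
  using pseudometric by (auto simp: pseudometric_on_def)

lemma openin_ball:
  assumes "x \<in> topspace X"
  shows "openin X {y \<in> topspace X. d x y < r}"
  unfolding openin_iff
proof (intro conjI ballI)
  fix y assume y: "y \<in> {y \<in> topspace X. d x y < r}"
  then have "{z \<in> topspace X. d y z < r - d x y} \<subseteq> {y \<in> topspace X. d x y < r}"
    using dist_triangle[OF assms, of y] by fastforce
  moreover have "r - d x y > 0" using y by simp
  ultimately show "\<exists>s>0. {z \<in> topspace X. d y z < s} \<subseteq> {y \<in> topspace X. d x y < r}"
    by blast
qed auto

lemma cluster_point_iff_dist:
  assumes "range y \<subseteq> topspace X"
  shows "cluster_point X y l \<longleftrightarrow>
    l \<in> topspace X \<and> (\<forall>e>0. \<exists>\<^sub>F n in sequentially. d l (y n) < e)"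
proof (intro iffI conjI allI impI)
  assume cl: "cluster_point X y l"
  then show l: "l \<in> topspace X" by (simp add: cluster_point_def)
  fix e :: real assume "e > 0"
  then have "l \<in> {z \<in> topspace X. d l z < e}"
    using l dist_self by simp
  with cl openin_ball[OF l] have "\<exists>\<^sub>F n in sequentially. y n \<in> {z \<in> topspace X. d l z < e}"
    unfolding cluster_point_def by blast
  then show "\<exists>\<^sub>F n in sequentially. d l (y n) < e"
    by (rule frequently_elim1) simp
next
  assume r: "l \<in> topspace X \<and> (\<forall>e>0. \<exists>\<^sub>F n in sequentially. d l (y n) < e)"
  show "cluster_point X y l"
    unfolding cluster_point_def
  proof (intro conjI allI impI)
    fix U assume "openin X U \<and> l \<in> U"
    then obtain e where e: "e > 0" "{z \<in> topspace X. d l z < e} \<subseteq> U"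
      using openin_iff by blast
    from r e(1) have "\<exists>\<^sub>F n in sequentially. d l (y n) < e" by blast
    then show "\<exists>\<^sub>F n in sequentially. y n \<in> U"
      by (rule frequently_elim1) (use e(2) assms in blast)
  qed (use r in simp)
qed

text \<open>Extracting a subsequence from a cluster point works because the balls of radius
  \<open>1 / (k + 1)\<close> form a countable neighbourhood basis; the converse holds in every space.\<close>

lemma has_convergent_subseq_iff_cluster_point:
  assumes y: "range y \<subseteq> topspace X"
  shows "has_convergent_subseq X y \<longleftrightarrow> (\<exists>l. cluster_point X y l)"
proof
  assume "has_convergent_subseq X y"
  then obtain \<nu> l where \<nu>: "filterlim \<nu> at_top sequentially"
    and l: "limitin X (\<lambda>k. y (\<nu> k)) l sequentially"
    by (auto simp: has_convergent_subseq_def)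
  have "\<exists>\<^sub>F n in sequentially. y n \<in> U" if "openin X U" "l \<in> U" for U
    unfolding frequently_sequentially
  proof
    fix N
    have "\<forall>\<^sub>F k in sequentially. y (\<nu> k) \<in> U \<and> N \<le> \<nu> k"
      using l that \<nu> by (intro eventually_conj) (auto simp: limitin_def filterlim_at_top)
    then show "\<exists>n\<ge>N. y n \<in> U"
      using eventually_happens' trivial_limit_sequentially by blast
  qed
  then show "\<exists>l. cluster_point X y l"
    using l by (auto simp: cluster_point_def limitin_def)
next
  assume "\<exists>l. cluster_point X y l"
  then obtain l where l: "l \<in> topspace X"
    and freq: "\<And>e. e > 0 \<Longrightarrow> \<exists>\<^sub>F n in sequentially. d l (y n) < e"
    using cluster_point_iff_dist[OF y] by blast
  obtain \<nu> where \<nu>: "strict_mono \<nu>" "\<And>k. d l (y (\<nu> k)) < inverse (real (Suc k))"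
    using subseq_below_inverse_Suc[OF freq] by blast
  have "limitin X (\<lambda>k. y (\<nu> k)) l sequentially"
    unfolding limitin_def
  proof (intro conjI allI impI)
    fix U assume "openin X U \<and> l \<in> U"
    then obtain e where e: "e > 0" "{z \<in> topspace X. d l z < e} \<subseteq> U"
      using openin_iff by blast
    show "\<forall>\<^sub>F k in sequentially. y (\<nu> k) \<in> U"
      using inverse_Suc_eventually_less[OF e(1)]
    proof eventually_elim
      case (elim k)
      with \<nu>(2)[of k] have "d l (y (\<nu> k)) < e" by linarith
      with y e(2) show ?case by blast
    qed
  qed (fact l)
  then show "has_convergent_subseq X y"
    unfolding has_convergent_subseq_def using filterlim_subseq[OF \<nu>(1)] by blast
qed

text \<open>Points at distance zero from each other lie in the same open sets. Choosing one
  representative \<open>r x\<close> from each class of such points therefore loses nothing as far as covers are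
  concerned, and on the representatives \<open>d\<close> is a genuine metric, for which sequential compactness
  is known to imply compactness.\<close>

lemma compactin_if_cluster_points:
  assumes C: "C \<subseteq> topspace X"
    and cluster: "\<And>z. range z \<subseteq> C \<Longrightarrow> \<exists>l\<in>C. cluster_point X z l"
  shows "compactin X C"
proof -
  define r where "r x = (SOME y. y \<in> topspace X \<and> d x y = 0)" for x
  have r: "r x \<in> topspace X \<and> d x (r x) = 0" if "x \<in> topspace X" for x
    unfolding r_def by (rule someI[of _ x]) (use that dist_self in simp)
  then have r': "d (r x) x = 0" if "x \<in> topspace X" for x
    using that dist_commute by metis
  \<comment> \<open>Moving both points by distance zero does not change \<open>d\<close>, by the triangle inequality. Hence
    points at distance zero satisfy the same defining predicate of \<open>r\<close>, and the choice operator
    gives them the same representative.\<close>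
  have d_r: "d (r x) (r y) = d x y" if "x \<in> topspace X" "y \<in> topspace X" for x y
  proof (rule antisym)
    show "d (r x) (r y) \<le> d x y"
      using dist_triangle[of "r x" x "r y"] dist_triangle[of x y "r y"] r r' that by fastforce
    show "d x y \<le> d (r x) (r y)"
      using dist_triangle[of x "r x" y] dist_triangle[of "r x" "r y" y] r r' that by fastforce
  qed
  have r_eqI: "r x = r y" if "x \<in> topspace X" "y \<in> topspace X" "d x y = 0" for x y
  proof -
    have "d x z = d y z" if "z \<in> topspace X" for z
      using dist_triangle[of x y z] dist_triangle[of y x z] that \<open>x \<in> _\<close> \<open>y \<in> _\<close> \<open>d x y = 0\<close>
        dist_commute[of x y] by fastforce
    then show ?thesis unfolding r_def by metis
  qed
  define M where "M = r ` topspace X"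
  have M: "M \<subseteq> topspace X" using r by (auto simp: M_def)
  \<comment> \<open>Outside the carrier \<open>d\<close> is arbitrary, whereas a metric has to be symmetric and nonnegative
    everywhere.\<close>
  define \<delta> where "\<delta> x y = (if x \<in> M \<and> y \<in> M then d x y else 0)" for x y
  have \<delta>: "\<delta> x y = d x y" if "x \<in> M" "y \<in> M" for x y
    using that by (simp add: \<delta>_def)
  interpret R: Metric_space M \<delta>
  proof
    show "0 \<le> \<delta> x y" for x y
      using M dist_nonneg by (auto simp: \<delta>_def)
    show "\<delta> x y = \<delta> y x" for x y
      using M dist_commute by (auto simp: \<delta>_def)
    show "\<delta> x y = 0 \<longleftrightarrow> x = y" if xy: "x \<in> M" "y \<in> M" for x y
    proof -
      obtain a b where ab: "a \<in> topspace X" "x = r a" "b \<in> topspace X" "y = r b"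
        using xy by (auto simp: M_def)
      show ?thesis
      proof
        assume "\<delta> x y = 0"
        then have "d a b = 0" using ab xy d_r by (simp add: \<delta>)
        then show "x = y" using ab r_eqI by simp
      next
        assume "x = y"
        then show "\<delta> x y = 0" using xy M dist_self[of x] by (auto simp: \<delta>)
      qed
    qed
    show "\<delta> x z \<le> \<delta> x y + \<delta> y z" if "x \<in> M" "y \<in> M" "z \<in> M" for x y z
      using that M dist_triangle[of x y z] by (auto simp: \<delta>)
  qed
  have rC: "r ` C \<subseteq> M" using C by (auto simp: M_def)
  have "compactin R.mtopology (r ` C)"
    unfolding R.compactin_sequentially
  proof (intro conjI allI impI rC)
    fix w :: "nat \<Rightarrow> 'a" assume w: "range w \<subseteq> r ` C"
    then have "\<forall>n. \<exists>x. x \<in> C \<and> w n = r x" by blast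
    then obtain z where z: "\<And>n. z n \<in> C" "\<And>n. w n = r (z n)" by metis
    then obtain l where l: "l \<in> C" "cluster_point X z l"
      using cluster[of z] by blast
    have "\<exists>\<^sub>F n in sequentially. d l (z n) < e" if "e > 0" for e
      using l(2) cluster_point_iff_dist[of z l] z(1) C that by blast
    then obtain \<nu> where \<nu>: "strict_mono \<nu>" "\<And>k. d l (z (\<nu> k)) < inverse (real (Suc k))"
      using subseq_below_inverse_Suc[of "\<lambda>n. d l (z n)"] by blast
    have "limitin R.mtopology (w \<circ> \<nu>) (r l) sequentially"
      unfolding R.limitin_metric
    proof (intro conjI allI impI)
      show "r l \<in> M" using rC l(1) by blast
      fix e :: real assume "e > 0"
      from inverse_Suc_eventually_less[OF this]
      show "\<forall>\<^sub>F k in sequentially. (w \<circ> \<nu>) k \<in> M \<and> \<delta> ((w \<circ> \<nu>) k) (r l) < e"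
      proof eventually_elim
        case (elim k)
        have "w (\<nu> k) \<in> M" "r l \<in> M" using w rC l(1) by blast+
        moreover have "d (w (\<nu> k)) (r l) = d l (z (\<nu> k))"
          using z l(1) C d_r[of "z (\<nu> k)" l] dist_commute[of l "z (\<nu> k)"] by (metis subsetD)
        ultimately show ?case using elim \<nu>(2)[of k] by (simp add: \<delta>)
      qed
    qed
    then show "\<exists>l s. l \<in> r ` C \<and> strict_mono s \<and> limitin R.mtopology (w \<circ> s) l sequentially"
      using l(1) \<nu>(1) by blast
  qed
  \<comment> \<open>The metric topology on the representatives is at least as fine as the subspace topology, so
    compactness carries over to \<open>X\<close>.\<close>
  moreover have "continuous_map R.mtopology X id"
    unfolding continuous_map_def
  proof (intro conjI allI impI)
    fix U assume U: "openin X U"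
    show "openin R.mtopology {x \<in> topspace R.mtopology. id x \<in> U}"
      unfolding R.openin_mtopology
    proof (intro conjI allI impI)
      fix x assume "x \<in> {x \<in> topspace R.mtopology. id x \<in> U}"
      then have x: "x \<in> M" "x \<in> U" by auto
      then obtain e where e: "e > 0" "{y \<in> topspace X. d x y < e} \<subseteq> U"
        using U openin_iff by blast
      have "R.mball x e \<subseteq> {x \<in> topspace R.mtopology. id x \<in> U}"
        using e(2) x(1) M by (auto simp: R.mball_def \<delta>)
      with e(1) show "\<exists>e>0. R.mball x e \<subseteq> {x \<in> topspace R.mtopology. id x \<in> U}" by blast
    qed auto
  qed (use M in auto)
  ultimately have compact: "compactin X (r ` C)"
    using image_compactin by fastforce
  have same_open: "x \<in> U" if "openin X U" "r x \<in> U" "x \<in> topspace X" for x U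
    using that openin_iff[of U] r' by fastforce
  show ?thesis
    unfolding compactin_def
  proof (intro conjI allI impI C)
    fix \<U> assume \<U>: "(\<forall>U\<in>\<U>. openin X U) \<and> C \<subseteq> \<Union> \<U>"
    have "r ` C \<subseteq> \<Union> \<U>"
    proof
      fix p assume "p \<in> r ` C"
      then obtain x where x: "x \<in> C" "p = r x" by blast
      then obtain U where "U \<in> \<U>" "x \<in> U" using \<U> by blast
      then show "p \<in> \<Union> \<U>"
        using \<U> x C r[of x] openin_iff[of U] by fastforce
    qed
    then obtain \<F> where \<F>: "finite \<F>" "\<F> \<subseteq> \<U>" "r ` C \<subseteq> \<Union> \<F>"
      using compactinD[OF compact, of \<U>] \<U> by blast
    have "C \<subseteq> \<Union> \<F>"
    proof
      fix x assume x: "x \<in> C"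
      then obtain U where "U \<in> \<F>" "r x \<in> U" using \<F>(3) by blast
      moreover from this have "openin X U" using \<F>(2) \<U> by blast
      ultimately show "x \<in> \<Union> \<F>" using same_open x C by blast
    qed
    with \<F>(1,2) show "\<exists>\<F>. finite \<F> \<and> \<F> \<subseteq> \<U> \<and> C \<subseteq> \<Union> \<F>" by blast
  qed
qed

end

section \<open>Compactness notions for nets of sets\<close>

lemma tail_union_mono:
  assumes "directed_set S le" "s \<in> S" "t \<in> S" "le s t"
  shows "tail_union S le F t \<subseteq> tail_union S le F s"
  using assms unfolding tail_union_def directed_set_def transp_on_def by blast

lemma tail_union_self:
  assumes "directed_set S le" "s \<in> S"
  shows "F s \<subseteq> tail_union S le F s"
  using assms unfolding tail_union_def directed_set_def reflp_on_def by blast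

text \<open>A sequence tending to \<open>bd(S)\<close> becomes monotone when each term is replaced by an upper bound
  of itself and the term constructed before.\<close>

lemma sequential_directed_monotone_final_seq:
  assumes dir: "directed_set S le" and seq: "sequential_directed S le"
  obtains \<sigma> where "range \<sigma> \<subseteq> S" "monotone (\<le>) le \<sigma>" "final_seq S le \<sigma>"
proof -
  obtain \<tau> where \<tau>: "range \<tau> \<subseteq> S" "tends_to_bd S le \<tau>"
    using seq by (auto simp: sequential_directed_def)
  have refl: "le s s" if "s \<in> S" for s
    using dir that by (auto simp: directed_set_def reflp_on_def)
  have trans: "le s u" if "le s t" "le t u" "s \<in> S" "t \<in> S" "u \<in> S" for s t u
    using dir that unfolding directed_set_def transp_on_def by blast
  have up: "\<exists>u\<in>S. le s u \<and> le t u" if "s \<in> S" "t \<in> S" for s t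
    using dir that by (auto simp: directed_set_def)
  have "\<exists>\<sigma>. \<forall>n. (\<sigma> n \<in> S \<and> le (\<tau> n) (\<sigma> n)) \<and> le (\<sigma> n) (\<sigma> (Suc n))"
  proof (rule dependent_nat_choice)
    show "\<exists>s. s \<in> S \<and> le (\<tau> 0) s" using refl \<tau>(1) by blast
    show "\<exists>t. (t \<in> S \<and> le (\<tau> (Suc n)) t) \<and> le s t" if "s \<in> S \<and> le (\<tau> n) s" for s n
      using up[of "\<tau> (Suc n)" s] that \<tau>(1) by blast
  qed
  then obtain \<sigma> where \<sigma>: "\<And>n. \<sigma> n \<in> S" "\<And>n. le (\<tau> n) (\<sigma> n)" "\<And>n. le (\<sigma> n) (\<sigma> (Suc n))"
    by blast
  have "le (\<sigma> m) (\<sigma> n)" if "m \<le> n" for m n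
    using that by (induction rule: dec_induct) (use refl trans \<sigma> in blast)+
  then have "monotone (\<le>) le \<sigma>" by (simp add: monotone_def)
  moreover have "final_seq S le \<sigma>"
    unfolding final_seq_def
  proof
    fix s assume s: "s \<in> S"
    then obtain n where "le s (\<tau> n)" using \<tau>(2) by (auto simp: tends_to_bd_def)
    with s show "\<exists>n. le s (\<sigma> n)" using trans[of s "\<tau> n" "\<sigma> n"] \<sigma> \<tau>(1) by blast
  qed
  ultimately show thesis using that \<sigma>(1) by blast
qed

lemma eventually_in_tail_union:
  assumes dir: "directed_set S le"
    and \<sigma>: "range \<sigma> \<subseteq> S" "monotone (\<le>) le \<sigma>" "final_seq S le \<sigma>"
    and y: "\<And>n. y n \<in> tail_union S le F (\<sigma> n)" and s: "s \<in> S"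
  shows "\<forall>\<^sub>F n in sequentially. y n \<in> tail_union S le F s"
proof -
  obtain n0 where n0: "le s (\<sigma> n0)" using \<sigma>(3) s by (auto simp: final_seq_def)
  have "tail_union S le F (\<sigma> n) \<subseteq> tail_union S le F s" if "n0 \<le> n" for n
    using tail_union_mono[OF dir, of "\<sigma> n0" "\<sigma> n" F] tail_union_mono[OF dir s _ n0, of F]
      monotoneD[OF \<sigma>(2) that] \<sigma>(1) by blast
  with y show ?thesis unfolding eventually_sequentially by blast
qed

lemma cluster_point_in_limit_set:
  assumes l: "cluster_point X y l"
    and ev: "\<And>s. s \<in> S \<Longrightarrow> \<forall>\<^sub>F n in sequentially. y n \<in> tail_union S le F s"
  shows "l \<in> limit_set X S le F"
  unfolding limit_set_def
proof
  fix s assume s: "s \<in> S"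
  have "\<exists>p. p \<in> tail_union S le F s \<and> p \<in> U" if "l \<in> U \<and> openin X U" for U
  proof -
    have "\<exists>\<^sub>F n in sequentially. y n \<in> U"
      using l that by (auto simp: cluster_point_def)
    from frequently_ex[OF frequently_eventually_frequently[OF this ev[OF s]]]
    show ?thesis by blast
  qed
  with l show "l \<in> X closure_of tail_union S le F s"
    by (auto simp: in_closure_of cluster_point_def)
qed

text \<open>If no point of \<open>K\<close> were a cluster point, then finitely many open sets, each containing only
  finitely many terms of the sequence, would cover \<open>K\<close>; but their union is a neighbourhood of
  \<open>K\<close>, and it contains all late terms.\<close>

lemma cluster_point_if_converges_from_above:
  assumes K: "compactin X K" and conv: "converges_from_above X S le F K"
    and ev: "\<And>s. s \<in> S \<Longrightarrow> \<forall>\<^sub>F n in sequentially. y n \<in> tail_union S le F s"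
  shows "\<exists>l\<in>K. cluster_point X y l"
proof (rule ccontr)
  assume "\<not> ?thesis"
  then have none: "\<And>l. l \<in> K \<Longrightarrow> \<not> cluster_point X y l" by blast
  let ?\<U> = "{U. openin X U \<and> (\<forall>\<^sub>F n in sequentially. y n \<notin> U)}"
  have "K \<subseteq> \<Union>?\<U>"
  proof
    fix l assume "l \<in> K"
    then show "l \<in> \<Union>?\<U>"
      using none[of l] compactin_subset_topspace[OF K]
      by (auto simp: cluster_point_def not_frequently)
  qed
  then obtain \<F> where \<F>: "finite \<F>" "\<F> \<subseteq> ?\<U>" "K \<subseteq> \<Union>\<F>"
    using compactinD[OF K, of ?\<U>] by blast
  have "openin X (\<Union>\<F>)" using \<F>(2) by blast
  then have "nbhd_of_set X K (\<Union>\<F>)"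
    unfolding nbhd_of_set_def using \<F>(3) openin_subset by blast
  then obtain s where s: "s \<in> S" "tail_union S le F s \<subseteq> \<Union>\<F>"
    using conv by (auto simp: converges_from_above_def)
  have "\<forall>\<^sub>F n in sequentially. \<forall>U\<in>\<F>. y n \<notin> U"
    using \<F>(1,2) by (subst eventually_ball_finite_distrib) auto
  then have "\<forall>\<^sub>F n in sequentially. False"
    using ev[OF s(1)] by eventually_elim (use s(2) in blast)
  then show False by simp
qed

text \<open>A point of a tail belongs to a member of the net with larger index, so a sequence running
  along the tails of a monotone final sequence runs along a subnet.\<close>

lemma asymptotically_imp_weakly_asymptotically_seq_compact:
  assumes dir: "directed_set S le" and asc: "asymptotically_seq_compact X S le F"
  shows "weakly_asymptotically_seq_compact X S le F"
  unfolding weakly_asymptotically_seq_compact_def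
proof (intro conjI allI impI)
  show "sequential_directed S le" using asc by (simp add: asymptotically_seq_compact_def)
  fix \<sigma> y
  assume A: "range \<sigma> \<subseteq> S \<and> monotone (\<le>) le \<sigma> \<and> final_seq S le \<sigma> \<and>
    (\<forall>n. y n \<in> tail_union S le F (\<sigma> n))"
  then have "\<forall>n. \<exists>t. t \<in> S \<and> le (\<sigma> n) t \<and> y n \<in> F t"
    by (auto simp: tail_union_def)
  then obtain \<tau> where \<tau>: "\<And>n. \<tau> n \<in> S" "\<And>n. le (\<sigma> n) (\<tau> n)" "\<And>n. y n \<in> F (\<tau> n)"
    by metis
  have "tends_to_bd S le \<tau>"
    unfolding tends_to_bd_def
  proof
    fix s assume s: "s \<in> S"
    then obtain n0 where n0: "le s (\<sigma> n0)" using A by (auto simp: final_seq_def)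
    have "le s (\<tau> n)" if "n0 \<le> n" for n
    proof -
      have "le (\<sigma> n0) (\<sigma> n)" using A that by (simp add: monotone_def)
      moreover have "transp_on S le" using dir by (simp add: directed_set_def)
      ultimately show ?thesis
        using n0 s \<tau>(1,2)[of n] A unfolding transp_on_def by (meson rangeI subsetD)
    qed
    then show "\<exists>n0. \<forall>n\<ge>n0. le s (\<tau> n)" by blast
  qed
  then show "has_convergent_subseq X y"
    using asc \<tau> unfolding asymptotically_seq_compact_def by blast
qed

context pseudometric_topology
begin

lemma converges_from_above_imp_asymptotically_seq_compact:
  assumes seq: "sequential_directed S le" and F: "\<And>s. s \<in> S \<Longrightarrow> F s \<subseteq> topspace X"
    and K: "compactin X K" "converges_from_above X S le F K"
  shows "asymptotically_seq_compact X S le F"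
  unfolding asymptotically_seq_compact_def
proof (intro conjI allI impI)
  fix \<sigma> y assume A: "range \<sigma> \<subseteq> S \<and> tends_to_bd S le \<sigma> \<and> (\<forall>n. y n \<in> F (\<sigma> n))"
  have "\<forall>\<^sub>F n in sequentially. y n \<in> tail_union S le F s" if "s \<in> S" for s
  proof -
    have "\<forall>\<^sub>F n in sequentially. le s (\<sigma> n)"
      using A that by (auto simp: tends_to_bd_def eventually_sequentially)
    then show ?thesis
      by (rule eventually_mono) (use A in \<open>auto simp: tail_union_def\<close>)
  qed
  then have "\<exists>l. cluster_point X y l"
    using cluster_point_if_converges_from_above[OF K] by blast
  moreover have "range y \<subseteq> topspace X" using A F by blast
  ultimately show "has_convergent_subseq X y"
    using has_convergent_subseq_iff_cluster_point by blast
qed (fact seq)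

text \<open>The limit set consists of the cluster points of sequences running along the tails of one fixed
  monotone final sequence \<open>\<sigma>\<close>. Each of the three parts of limit set compactness is reduced to the
  existence of a cluster point of a suitable sequence of this kind.\<close>

lemma weakly_asymptotically_seq_compact_imp_limit_set_compact:
  assumes dir: "directed_set S le"
    and F: "\<And>s. s \<in> S \<Longrightarrow> F s \<subseteq> topspace X \<and> F s \<noteq> {}"
    and wasc: "weakly_asymptotically_seq_compact X S le F"
  shows "limit_set_compact X S le F"
proof -
  let ?T = "tail_union S le F" and ?L = "limit_set X S le F"
  have "sequential_directed S le"
    using wasc by (simp add: weakly_asymptotically_seq_compact_def)
  then obtain \<sigma> where \<sigma>: "range \<sigma> \<subseteq> S" "monotone (\<le>) le \<sigma>" "final_seq S le \<sigma>"
    using sequential_directed_monotone_final_seq[OF dir] by blast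
  have T: "?T s \<subseteq> topspace X" for s
    using F by (auto simp: tail_union_def)
  have cluster: "\<exists>l\<in>?L. cluster_point X y l" if y: "\<And>n. y n \<in> ?T (\<sigma> n)" for y
  proof -
    have "has_convergent_subseq X y"
      using wasc \<sigma> y unfolding weakly_asymptotically_seq_compact_def by blast
    moreover have "range y \<subseteq> topspace X" using y T by blast
    ultimately obtain l where l: "cluster_point X y l"
      using has_convergent_subseq_iff_cluster_point by blast
    have "l \<in> ?L"
      by (rule cluster_point_in_limit_set[OF l])
        (rule eventually_in_tail_union[of S le \<sigma> y F], use dir \<sigma> y in auto)
    with l show ?thesis by blast
  qed
  show ?thesis
    unfolding limit_set_compact_def
  proof (intro conjI)
    have "\<exists>p. p \<in> ?T (\<sigma> n)" for n
      using F[of "\<sigma> n"] tail_union_self[OF dir, of "\<sigma> n" F] \<sigma>(1) by blast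
    then obtain y where "\<And>n. y n \<in> ?T (\<sigma> n)" by metis
    then show "?L \<noteq> {}" using cluster by blast
  next
    have L: "?L \<subseteq> topspace X"
      using dir closure_of_subset_topspace[of X] unfolding limit_set_def directed_set_def by blast
    show "compactin X ?L"
    proof (rule compactin_if_cluster_points[OF L])
      fix z :: "nat \<Rightarrow> 'a" assume z: "range z \<subseteq> ?L"
      \<comment> \<open>The points \<open>z n\<close> need not belong to any member of the net, only to closures of tails; nearby
        points \<open>y n\<close> of the tails at \<open>\<sigma> n\<close> have the same cluster points.\<close>
      have zX: "z n \<in> topspace X" for n using z L by blast
      have "\<exists>p. p \<in> ?T (\<sigma> n) \<and> d (z n) p < inverse (real (Suc n))" for n
      proof -
        let ?B = "{p \<in> topspace X. d (z n) p < inverse (real (Suc n))}"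
        have "z n \<in> X closure_of ?T (\<sigma> n)"
          using z \<sigma>(1) unfolding limit_set_def by blast
        moreover have "z n \<in> ?B \<and> openin X ?B"
          using zX dist_self openin_ball[OF zX] by simp
        ultimately obtain p where "p \<in> ?T (\<sigma> n)" "p \<in> ?B"
          unfolding in_closure_of by meson
        then show ?thesis by blast
      qed
      then obtain y where y: "\<And>n. y n \<in> ?T (\<sigma> n)"
          "\<And>n. d (z n) (y n) < inverse (real (Suc n))"
        by metis
      have yX: "y n \<in> topspace X" for n using y(1) T by blast
      obtain l where l: "l \<in> ?L" "cluster_point X y l"
        using cluster[OF y(1)] by blast
      have "\<exists>\<^sub>F n in sequentially. d l (z n) < e" if "e > 0" for e
      proof -
        have "\<exists>\<^sub>F n in sequentially. d l (y n) < e / 2"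
          using l(2) cluster_point_iff_dist[of y l] yX half_gt_zero[OF that] by blast
        then have "\<exists>\<^sub>F n in sequentially. d l (y n) < e / 2 \<and> inverse (real (Suc n)) < e / 2"
          by (rule frequently_eventually_frequently)
            (use that in \<open>intro inverse_Suc_eventually_less, simp\<close>)
        then show ?thesis
        proof (rule frequently_elim1)
          fix n assume "d l (y n) < e / 2 \<and> inverse (real (Suc n)) < e / 2"
          then show "d l (z n) < e"
            using y(2)[of n] dist_triangle[of l "y n" "z n"] dist_commute[OF zX yX, of n n]
              l(1) L yX zX by fastforce
        qed
      qed
      then have "cluster_point X z l"
        using cluster_point_iff_dist[of z l] zX l(1) L by blast
      with l(1) show "\<exists>l\<in>?L. cluster_point X z l" by blast
    qed
  next
    show "converges_from_above X S le F ?L"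
      unfolding converges_from_above_def
    proof (intro allI impI)
      fix U assume "nbhd_of_set X ?L U"
      then obtain V where V: "openin X V" "?L \<subseteq> V" "V \<subseteq> U"
        by (auto simp: nbhd_of_set_def)
      \<comment> \<open>Otherwise some sequence along the tails avoids \<open>V\<close>, but clusters in \<open>?L\<close>.\<close>
      have "\<exists>n. ?T (\<sigma> n) \<subseteq> V"
      proof (rule ccontr)
        assume "\<not> (\<exists>n. ?T (\<sigma> n) \<subseteq> V)"
        then have "\<forall>n. \<exists>p. p \<in> ?T (\<sigma> n) \<and> p \<notin> V" by blast
        then obtain y where y: "\<And>n. y n \<in> ?T (\<sigma> n)" "\<And>n. y n \<notin> V" by metis
        obtain l where "l \<in> ?L" "cluster_point X y l"
          using cluster[OF y(1)] by blast
        then have "\<exists>\<^sub>F n in sequentially. y n \<in> V"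
          using V(1,2) unfolding cluster_point_def by blast
        with y(2) show False by simp
      qed
      with V(3) \<sigma>(1) show "\<exists>s\<in>S. ?T s \<subseteq> U" by blast
    qed
  qed
qed

end

theorem theorem5p19:
  fixes X :: "'a topology" and S :: "'s set" and le :: "'s \<Rightarrow> 's \<Rightarrow> bool"
    and F :: "'s \<Rightarrow> 'a set"
  assumes "pseudo_metrizable_space X"
    and "directed_set S le"
    and "sequential_directed S le"
    and "\<And>s. s \<in> S \<Longrightarrow> F s \<subseteq> topspace X \<and> F s \<noteq> {}"
  shows "((\<exists>K. K \<noteq> {} \<and> compactin X K \<and> converges_from_above X S le F K)
            \<longleftrightarrow> asymptotically_seq_compact X S le F) \<and>
         (asymptotically_seq_compact X S le F
            \<longleftrightarrow> weakly_asymptotically_seq_compact X S le F) \<and>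
         (weakly_asymptotically_seq_compact X S le F
            \<longleftrightarrow> limit_set_compact X S le F)"
proof -
  obtain d where "pseudometric_topology X d"
    using assms(1) unfolding pseudo_metrizable_space_def pseudometric_topology_def by blast
  then interpret pseudometric_topology X d .
  have "asymptotically_seq_compact X S le F"
    if "\<exists>K. K \<noteq> {} \<and> compactin X K \<and> converges_from_above X S le F K"
    using converges_from_above_imp_asymptotically_seq_compact assms(3,4) that by blast
  moreover have "weakly_asymptotically_seq_compact X S le F"
    if "asymptotically_seq_compact X S le F"
    using asymptotically_imp_weakly_asymptotically_seq_compact[OF assms(2) that] .
  moreover have "limit_set_compact X S le F"
    if "weakly_asymptotically_seq_compact X S le F"
    using weakly_asymptotically_seq_compact_imp_limit_set_compact[OF assms(2,4) that] .
  moreover have "\<exists>K. K \<noteq> {} \<and> compactin X K \<and> converges_from_above X S le F K"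
    if "limit_set_compact X S le F"
    using that unfolding limit_set_compact_def by blast
  ultimately show ?thesis by blast
qed

end
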